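(* Let $(X_1,\dots,X_n)$ be an $n$-tuple in $\mathbb R^m$ of type $O(n)$, $e_{n+1},\dots,e_m$ a common parallel normal frame, and $(x_1,\dots,x_n)$ common spherical line of curvature coordinates for all $X_j$'s, such that the two fundamental forms $I_j,II_j$ of $X_j$ are given by $$I_j=\sum_{i=1}^nb_{ji}^2\,dx_i^2,\qquad II_j=\sum_{i=1}^n\sum_{k=1}^{m-n}b_{ji}g_{ki}\,dx_i^2\,e_{n+k}\qquad(1)$$ with $B=(b_{ij})$ an $O(n)$-valued map and $G=(g_{ij})$ an $\mathcal M_{(m-n)\times n}$-valued map. Set $f_{ij}=(b_{1j})_{x_i}/b_{1i}$ if $i\ne j$, $f_{ii}=0$, and $F=(f_{ij})$. If all entries of $G$ are non-zero, then $(F,G,B)$ is a solution of the $G_{m,n}$-system II.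
   Context: $\mathcal M_{p\times q}$: real $p\times q$ matrices; $gl_*(n)$: real $n\times n$ matrices with zero diagonal. $n$-tuple of type $O(n)$: let $m>n$, $\mathcal O$ a domain in $\mathbb R^n$, and $X_i:\mathcal O\to\mathbb R^m$ an immersion with flat and non-degenerate normal bundle for $1\le i\le n$. $(X_1,\dots,X_n)$ is an $n$-tuple in $\mathbb R^m$ of type $O(n)$ if (i) the normal plane of $X_i(x)$ is parallel to the normal plane of $X_j(x)$ for all $i,j$ and $x\in\mathcal O$; (ii) there exists a common parallel normal frame $\{e_\alpha\}_{\alpha=n+1}^m$; (iii) $x\in\mathcal O$ is a spherical line of curvature coordinate system with respect to $\{e_\alpha\}$ for each $X_j$, such that the fundamental forms of $X_j$ are of the form (1) for some $O(n)$-valued map $B=(b_{ij})$ and $\mathcal M_{(m-n)\times n}$-valued map $G=(g_{ij})$. The normal bundle of an $n$-dimensional submanifold is non-degenerate if at each point the space of shape operators $\{A_v:v\text{ normal}\}$ has dimension $n$. Line of curvature coordinates with respect to an orthonormal parallel normal frame are coordinates with $I=\sum_ia_i^2dx_i^2$ and $II=\sum_{i,j}c_{ji}dx_i^2e_{n+j}$; spherical means in addition $\sum_ia_i^2=1$. Convention: with $\omega_i=\langle dX,e_i\rangle$, $\omega_{i\alpha}=\langle e_i,de_\alpha\rangle$ for an orthonormal tangent frame $e_i$ and normal frame $e_\alpha$, $I=\sum\omega_i^2$, $II=\sum_{i,\alpha}\omega_{i\alpha}\omega_ie_\alpha$. The $G_{m,n}$-system II is the PDE for $(F,G,B)=((f_{ij}),(g_{ij}),(b_{ij}))$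 with values in $gl_*(n)\times\mathcal M_{(m-n)\times n}\times O(n)$: $(f_{ij})_{x_i}+(f_{ji})_{x_j}+\sum_{k=1}^nf_{ki}f_{kj}+\sum_{k=1}^{m-n}g_{ki}g_{kj}=0$ if $i\ne j$; $(f_{ij})_{x_k}=f_{ik}f_{kj}$ if $i,j,k$ are distinct; $(b_{ij})_{x_k}=f_{kj}b_{ik}$ if $j\ne k$; $(g_{ij})_{x_k}=f_{kj}g_{ik}$ if $j\ne k$. *)

theory Defs
  imports "HOL-Analysis.Analysis"
begin

text \<open>
  Points of the coordinate domain live in \<open>real^'n\<close>, with \<open>n = CARD('n)\<close>. The ambient space
  is \<open>real^('n + 'p)\<close>, so \<open>m = CARD('n) + CARD('p) > n\<close>; the type \<open>'p\<close> indexes the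
  \<open>m - n\<close> normal directions, and \<open>e k\<close> stands for \<open>e_{n+k}\<close>.
\<close>

text \<open>The two notions below are meant for open sets \<open>S\<close> only.\<close>

primrec Ck_on :: "nat \<Rightarrow> 'a::euclidean_space set \<Rightarrow> ('a \<Rightarrow> 'b::euclidean_space) \<Rightarrow> bool" where
  "Ck_on 0 S f \<longleftrightarrow> continuous_on S f"
| "Ck_on (Suc k) S f \<longleftrightarrow>
     (\<forall>x\<in>S. f differentiable (at x)) \<and> (\<forall>v. Ck_on k S (\<lambda>x. frechet_derivative f (at x) v))"

definition smooth_on :: "'a::euclidean_space set \<Rightarrow> ('a \<Rightarrow> 'b::euclidean_space) \<Rightarrow> bool" where
  "smooth_on S f \<longleftrightarrow> (\<forall>k. Ck_on k S f)"

definition partial_deriv :: "'n::finite \<Rightarrow> (real^'n \<Rightarrow> real) \<Rightarrow> real^'n \<Rightarrow> real" where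
  "partial_deriv i f x = frechet_derivative f (at x) (axis i 1)"

definition is_domain :: "'a::topological_space set \<Rightarrow> bool" where
  "is_domain D \<longleftrightarrow> open D \<and> connected D \<and> D \<noteq> {}"

definition immersion_on :: "(real^'n::finite) set \<Rightarrow> (real^'n \<Rightarrow> real^'m::finite) \<Rightarrow> bool" where
  "immersion_on D X \<longleftrightarrow> smooth_on D X \<and> (\<forall>x\<in>D. inj (frechet_derivative X (at x)))"

definition normal_space :: "(real^'n::finite \<Rightarrow> real^'m::finite) \<Rightarrow> real^'n \<Rightarrow> (real^'m) set" where
  "normal_space X x = {v. \<forall>u. orthogonal v (frechet_derivative X (at x) u)}"

text \<open>The nearest point of a linear subspace is the orthogonal projection onto it, so the
  following is the normal connection: the normal component of the derivative of \<open>\<xi>\<close> at \<open>x\<close>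
  in the direction \<open>u\<close>.\<close>

definition normal_conn ::
  "(real^'n::finite \<Rightarrow> real^'m::finite) \<Rightarrow> (real^'n \<Rightarrow> real^'m) \<Rightarrow> real^'n \<Rightarrow> real^'n \<Rightarrow> real^'m"
where
  "normal_conn X \<xi> x u = closest_point (normal_space X x) (frechet_derivative \<xi> (at x) u)"

definition normal_field_on ::
  "(real^'n::finite) set \<Rightarrow> (real^'n \<Rightarrow> real^'m::finite) \<Rightarrow> (real^'n \<Rightarrow> real^'m) \<Rightarrow> bool" where
  "normal_field_on D X \<xi> \<longleftrightarrow> smooth_on D \<xi> \<and> (\<forall>x\<in>D. \<xi> x \<in> normal_space X x)"

text \<open>Vanishing of the curvature of the normal connection. The directions \<open>u\<close>, \<open>v\<close> are constant
  coordinate fields, so their Lie bracket contributes no term.\<close>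

definition flat_normal_bundle ::
  "(real^'n::finite) set \<Rightarrow> (real^'n \<Rightarrow> real^'m::finite) \<Rightarrow> bool" where
  "flat_normal_bundle D X \<longleftrightarrow>
     (\<forall>\<xi>. normal_field_on D X \<xi> \<longrightarrow>
        (\<forall>x\<in>D. \<forall>u v. normal_conn X (\<lambda>y. normal_conn X \<xi> y u) x v
                    = normal_conn X (\<lambda>y. normal_conn X \<xi> y v) x u))"

definition first_form ::
  "(real^'n::finite \<Rightarrow> real^'m::finite) \<Rightarrow> real^'n \<Rightarrow> real^'n \<Rightarrow> real^'n \<Rightarrow> real" where
  "first_form X x u w = frechet_derivative X (at x) u \<bullet> frechet_derivative X (at x) w"

text \<open>The tangential shape operator in the direction of a normal vector \<open>v\<close> at \<open>x\<close>, pulled back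
  to the coordinate space along the differential of \<open>X\<close>: the operator that represents the bilinear
  form \<open>D\<^sup>2X(u, w) \<bullet> v\<close> with respect to the first fundamental form. For a normal field
  \<open>\<xi>\<close> this is \<open>- (d\<xi>)\<close> followed by tangential projection. It exists uniquely for an immersion.\<close>

definition shape_operator ::
  "(real^'n::finite \<Rightarrow> real^'m::finite) \<Rightarrow> real^'n \<Rightarrow> real^'m \<Rightarrow> real^'n \<Rightarrow> real^'n" where
  "shape_operator X x v =
     (THE A. linear A \<and>
        (\<forall>u w. first_form X x (A u) w =
           frechet_derivative (\<lambda>y. frechet_derivative X (at y) w) (at x) u \<bullet> v))"

text \<open>Operators are identified with their matrices in order to speak of the dimension of a
  space of operators.\<close>

definition nondegenerate_normal_bundle ::
  "(real^'n::finite) set \<Rightarrow> (real^'n \<Rightarrow> real^'m::finite) \<Rightarrow> bool" where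
  "nondegenerate_normal_bundle D X \<longleftrightarrow>
     (\<forall>x\<in>D. dim ((\<lambda>v. matrix (shape_operator X x v)) ` normal_space X x) = CARD('n))"

definition parallel_normal_frame ::
  "(real^'n::finite) set \<Rightarrow> (real^'n \<Rightarrow> real^('n + 'p::finite)) \<Rightarrow>
     ('p \<Rightarrow> real^'n \<Rightarrow> real^('n + 'p)) \<Rightarrow> bool" where
  "parallel_normal_frame D X e \<longleftrightarrow>
     (\<forall>k. normal_field_on D X (e k)) \<and>
     (\<forall>x\<in>D. \<forall>k l. e k x \<bullet> e l x = (if k = l then 1 else 0)) \<and>
     (\<forall>x\<in>D. \<forall>k u. normal_conn X (e k) x u = 0)"

text \<open>The second fundamental form is \<open>\<Sum>\<^sub>i\<^sub>,\<^sub>\<alpha> \<omega>\<^sub>i\<^sub>\<alpha> \<omega>\<^sub>i e\<^sub>\<alpha>\<close> with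
  \<open>\<omega>\<^sub>i = \<langle>dX, e\<^sub>i\<rangle>\<close> and \<open>\<omega>\<^sub>i\<^sub>\<alpha> = \<langle>e\<^sub>i, de\<^sub>\<alpha>\<rangle>\<close>. Since \<open>dX\<close> takes values in the span of the
  orthonormal tangent frame \<open>e\<^sub>i\<close>, the sum over \<open>i\<close> is \<open>\<langle>dX, de\<^sub>\<alpha>\<rangle>\<close>. With this sign convention
  the form is the negative of the normal part of the second derivative of \<open>X\<close>.\<close>

definition second_form ::
  "(real^'n::finite \<Rightarrow> real^'m::finite) \<Rightarrow> ('p::finite \<Rightarrow> real^'n \<Rightarrow> real^'m) \<Rightarrow>
     real^'n \<Rightarrow> real^'n \<Rightarrow> real^'n \<Rightarrow> real^'m" where
  "second_form X e x u w =
     (\<Sum>k\<in>UNIV. (frechet_derivative X (at x) u \<bullet> frechet_derivative (e k) (at x) w) *\<^sub>R e k x)"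

text \<open>\<open>I = \<Sum>\<^sub>i a\<^sub>i\<^sup>2 dx\<^sub>i\<^sup>2\<close>, \<open>II = \<Sum>\<^sub>i\<^sub>,\<^sub>k c\<^sub>k\<^sub>i dx\<^sub>i\<^sup>2 e\<^sub>n\<^sub>+\<^sub>k\<close>, as
  symmetric bilinear forms.\<close>

definition line_of_curvature_coords ::
  "(real^'n::finite) set \<Rightarrow> (real^'n \<Rightarrow> real^'m::finite) \<Rightarrow> ('p::finite \<Rightarrow> real^'n \<Rightarrow> real^'m) \<Rightarrow>
     (real^'n \<Rightarrow> real^'n) \<Rightarrow> (real^'n \<Rightarrow> real^'n^'p) \<Rightarrow> bool" where
  "line_of_curvature_coords D X e a c \<longleftrightarrow>
     (\<forall>x\<in>D. \<forall>u w. first_form X x u w = (\<Sum>i\<in>UNIV. (a x $ i)\<^sup>2 * (u $ i * w $ i))) \<and>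
     (\<forall>x\<in>D. \<forall>u w. second_form X e x u w =
        (\<Sum>i\<in>UNIV. \<Sum>k\<in>UNIV. (c x $ k $ i * (u $ i * w $ i)) *\<^sub>R e k x))"

definition spherical_line_of_curvature_coords ::
  "(real^'n::finite) set \<Rightarrow> (real^'n \<Rightarrow> real^'m::finite) \<Rightarrow> ('p::finite \<Rightarrow> real^'n \<Rightarrow> real^'m) \<Rightarrow>
     (real^'n \<Rightarrow> real^'n) \<Rightarrow> (real^'n \<Rightarrow> real^'n^'p) \<Rightarrow> bool" where
  "spherical_line_of_curvature_coords D X e a c \<longleftrightarrow>
     line_of_curvature_coords D X e a c \<and> (\<forall>x\<in>D. (\<Sum>i\<in>UNIV. (a x $ i)\<^sup>2) = 1)"

definition common_parallel_normal_frame ::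
  "(real^'n::finite) set \<Rightarrow> ('n \<Rightarrow> real^'n \<Rightarrow> real^('n + 'p::finite)) \<Rightarrow>
     ('p \<Rightarrow> real^'n \<Rightarrow> real^('n + 'p)) \<Rightarrow> bool" where
  "common_parallel_normal_frame D X e \<longleftrightarrow> (\<forall>j. parallel_normal_frame D (X j) e)"

text \<open>The coordinates are spherical line of curvature coordinates for every \<open>X j\<close>, with
  \<open>a\<^sub>i = b\<^sub>j\<^sub>i\<close> and \<open>c\<^sub>k\<^sub>i = b\<^sub>j\<^sub>i g\<^sub>k\<^sub>i\<close>, where \<open>B\<close> is a smooth \<open>O(n)\<close>-valued map and \<open>G\<close> a smooth
  matrix-valued map.\<close>

definition common_spherical_coords ::
  "(real^'n::finite) set \<Rightarrow> ('n \<Rightarrow> real^'n \<Rightarrow> real^('n + 'p::finite)) \<Rightarrow>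
     ('p \<Rightarrow> real^'n \<Rightarrow> real^('n + 'p)) \<Rightarrow> (real^'n \<Rightarrow> real^'n^'n) \<Rightarrow> (real^'n \<Rightarrow> real^'n^'p) \<Rightarrow> bool"
where
  "common_spherical_coords D X e B G \<longleftrightarrow>
     smooth_on D B \<and> (\<forall>x\<in>D. orthogonal_matrix (B x)) \<and> smooth_on D G \<and>
     (\<forall>j. spherical_line_of_curvature_coords D (X j) e
        (\<lambda>x. B x $ j) (\<lambda>x. \<chi> k i. B x $ j $ i * G x $ k $ i))"

definition tuple_of_type_O ::
  "(real^'n::finite) set \<Rightarrow> ('n \<Rightarrow> real^'n \<Rightarrow> real^('n + 'p::finite)) \<Rightarrow> bool" where
  "tuple_of_type_O D X \<longleftrightarrow>
     is_domain D \<and>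
     (\<forall>j. immersion_on D (X j) \<and> flat_normal_bundle D (X j) \<and>
          nondegenerate_normal_bundle D (X j)) \<and>
     (\<forall>i j. \<forall>x\<in>D. normal_space (X i) x = normal_space (X j) x) \<and>
     (\<exists>e B G. common_parallel_normal_frame D X e \<and> common_spherical_coords D X e B G)"

definition solves_system_II ::
  "(real^'n::finite) set \<Rightarrow> (real^'n \<Rightarrow> real^'n^'n) \<Rightarrow> (real^'n \<Rightarrow> real^'n^'p::finite) \<Rightarrow>
     (real^'n \<Rightarrow> real^'n^'n) \<Rightarrow> bool" where
  "solves_system_II D F G B \<longleftrightarrow>
     smooth_on D F \<and> smooth_on D G \<and> smooth_on D B \<and>
     (\<forall>x\<in>D. (\<forall>i. F x $ i $ i = 0) \<and> orthogonal_matrix (B x) \<and>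
       (\<forall>i j. i \<noteq> j \<longrightarrow>
          partial_deriv i (\<lambda>y. F y $ i $ j) x + partial_deriv j (\<lambda>y. F y $ j $ i) x
          + (\<Sum>k\<in>UNIV. F x $ k $ i * F x $ k $ j) + (\<Sum>k\<in>UNIV. G x $ k $ i * G x $ k $ j) = 0) \<and>
       (\<forall>i j k. i \<noteq> j \<and> j \<noteq> k \<and> i \<noteq> k \<longrightarrow>
          partial_deriv k (\<lambda>y. F y $ i $ j) x = F x $ i $ k * F x $ k $ j) \<and>
       (\<forall>i j k. j \<noteq> k \<longrightarrow>
          partial_deriv k (\<lambda>y. B y $ i $ j) x = F x $ k $ j * B x $ i $ k) \<and>
       (\<forall>i j k. j \<noteq> k \<longrightarrow>
          partial_deriv k (\<lambda>y. G y $ i $ j) x = F x $ k $ j * G x $ i $ k))"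

end

theory Submission
  imports Defs
begin

text \<open>
  A parallel normal field \<open>e\<^sub>k\<close> has tangential derivatives, and the second fundamental form gives
  \<open>\<partial>\<^sub>i e\<^sub>k = g\<^sub>k\<^sub>i / b\<^sub>j\<^sub>i \<partial>\<^sub>i X\<^sub>j\<close> for every \<open>j\<close>. As \<open>g\<^sub>k\<^sub>i \<noteq> 0\<close>, the unit tangent vectors
  \<open>u\<^sub>i = \<partial>\<^sub>i X\<^sub>j / b\<^sub>j\<^sub>i\<close> do not depend on \<open>j\<close>, so \<open>\<partial>\<^sub>i X\<^sub>j = b\<^sub>j\<^sub>i u\<^sub>i\<close> and \<open>\<partial>\<^sub>i e\<^sub>k = g\<^sub>k\<^sub>i u\<^sub>i\<close>.
  Equality of the mixed partial derivatives of all the \<open>X\<^sub>j\<close>, combined with the orthogonality of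
  \<open>B\<close>, yields \<open>\<partial>\<^sub>j u\<^sub>i = f\<^sub>i\<^sub>j u\<^sub>j\<close> for \<open>i \<noteq> j\<close>. The equations for \<open>B\<close> and \<open>G\<close> then come from the mixed
  partials of \<open>X\<^sub>j\<close> and \<open>e\<^sub>k\<close>, and those for \<open>F\<close> from the mixed partials of \<open>u\<^sub>i\<close>, where
  \<open>\<partial>\<^sub>i u\<^sub>i \<bullet> \<partial>\<^sub>j u\<^sub>j\<close> is expanded in the orthonormal frame formed by the \<open>u\<^sub>k\<close> and the \<open>e\<^sub>k\<close>.
\<close>

section \<open>Calculus of smooth maps\<close>

text \<open>A Frechet derivative at a point of an open set only sees values near that point, so
  agreement on \<open>S\<close> passes to all derivatives. This allows derivatives to be replaced by
  explicit formulas valid only on \<open>S\<close>.\<close>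

lemma Ck_on_cong:
  assumes "open S" "\<And>x. x \<in> S \<Longrightarrow> f x = g x"
  shows "Ck_on k S f \<longleftrightarrow> Ck_on k S g"
proof -
  have "Ck_on k S g" if "Ck_on k S f" "\<And>x. x \<in> S \<Longrightarrow> f x = g x" for f g :: "'a \<Rightarrow> 'b"
    using that
  proof (induction k arbitrary: f g)
    case 0
    then show ?case by (simp cong: continuous_on_cong)
  next
    case (Suc k)
    have D: "(f has_derivative frechet_derivative f (at x)) (at x)" if "x \<in> S" for x
      using Suc.prems that by (simp flip: frechet_derivative_works)
    have D': "(g has_derivative frechet_derivative f (at x)) (at x)" if "x \<in> S" for x
      using has_derivative_transform_within_open[OF D[OF that] \<open>open S\<close> that] Suc.prems(2) by simp
    have "frechet_derivative f (at x) = frechet_derivative g (at x)" if "x \<in> S" for x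
      using frechet_derivative_at[OF D'[OF that]] .
    then have "Ck_on k S (\<lambda>x. frechet_derivative g (at x) v)" for v
      using Suc.IH[of "\<lambda>x. frechet_derivative f (at x) v" "\<lambda>x. frechet_derivative g (at x) v"]
        Suc.prems by simp
    then show ?case using D' by (auto simp: differentiable_def)
  qed
  from this[of f g] this[of g f] show ?thesis using assms(2) by metis
qed

lemma smooth_on_cong:
  assumes "open S" "\<And>x. x \<in> S \<Longrightarrow> f x = g x"
  shows "smooth_on S f \<longleftrightarrow> smooth_on S g"
  using Ck_on_cong[OF assms] by (simp add: smooth_on_def)

lemma Ck_on_SucD: "Ck_on (Suc k) S f \<Longrightarrow> Ck_on k S f"
proof (induction k arbitrary: f)
  case 0
  then show ?case
    by (auto simp: continuous_on_eq_continuous_at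
        intro!: continuous_at_imp_continuous_on differentiable_imp_continuous_within)
next
  case (Suc k)
  have "Ck_on k S (\<lambda>x. frechet_derivative f (at x) v)" for v
    by (rule Suc.IH) (use Suc.prems in simp)
  then show ?case using Suc.prems by simp
qed

lemma Ck_on_const: "Ck_on k S (\<lambda>x. c)"
  by (induction k arbitrary: c) simp_all

lemma Ck_on_add:
  assumes "open S" "Ck_on k S f" "Ck_on k S g"
  shows "Ck_on k S (\<lambda>x. f x + g x)"
  using assms(2,3)
proof (induction k arbitrary: f g)
  case 0
  then show ?case by (simp add: continuous_on_add)
next
  case (Suc k)
  have D: "((\<lambda>x. f x + g x) has_derivative
      (\<lambda>v. frechet_derivative f (at x) v + frechet_derivative g (at x) v)) (at x)" if "x \<in> S" for x
    using Suc.prems that by (auto intro!: has_derivative_add simp flip: frechet_derivative_works)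
  have "Ck_on k S (\<lambda>x. frechet_derivative (\<lambda>x. f x + g x) (at x) v)" for v
  proof (subst Ck_on_cong[OF \<open>open S\<close>])
    show "frechet_derivative (\<lambda>x. f x + g x) (at x) v =
        frechet_derivative f (at x) v + frechet_derivative g (at x) v" if "x \<in> S" for x
      by (rule fun_cong[OF frechet_derivative_at[OF D[OF that]], symmetric])
    show "Ck_on k S (\<lambda>x. frechet_derivative f (at x) v + frechet_derivative g (at x) v)"
      using Suc.prems by (intro Suc.IH) simp_all
  qed
  then show ?case using D by (auto simp: differentiable_def)
qed

text \<open>The product rule expresses the derivative through two bilinear terms of lower order,
  which the induction hypothesis and closure under sums handle. One proof thus serves scalar
  multiples, inner products and real products.\<close>

lemma Ck_on_bilinear:
  assumes "bounded_bilinear h" "open S" "Ck_on k S f" "Ck_on k S g"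
  shows "Ck_on k S (\<lambda>x. h (f x) (g x))"
  using assms(3,4)
proof (induction k arbitrary: f g)
  case 0
  then show ?case by (simp add: bounded_bilinear.continuous_on[OF assms(1)])
next
  case (Suc k)
  have D: "((\<lambda>x. h (f x) (g x)) has_derivative
      (\<lambda>v. h (f x) (frechet_derivative g (at x) v) + h (frechet_derivative f (at x) v) (g x))) (at x)"
    if "x \<in> S" for x
    using Suc.prems that
    by (auto intro!: bounded_bilinear.FDERIV[OF assms(1)] simp flip: frechet_derivative_works)
  have "Ck_on k S (\<lambda>x. frechet_derivative (\<lambda>x. h (f x) (g x)) (at x) v)" for v
  proof (subst Ck_on_cong[OF \<open>open S\<close>])
    show "frechet_derivative (\<lambda>x. h (f x) (g x)) (at x) v =
        h (f x) (frechet_derivative g (at x) v) + h (frechet_derivative f (at x) v) (g x)"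
      if "x \<in> S" for x
      by (rule fun_cong[OF frechet_derivative_at[OF D[OF that]], symmetric])
    have "Ck_on k S f" "Ck_on k S g"
      using Suc.prems by (auto intro: Ck_on_SucD simp del: Ck_on.simps)
    then show "Ck_on k S (\<lambda>x. h (f x) (frechet_derivative g (at x) v) +
        h (frechet_derivative f (at x) v) (g x))"
      using Suc.prems by (intro Ck_on_add[OF \<open>open S\<close>] Suc.IH) simp_all
  qed
  then show ?case using D by (auto simp: differentiable_def)
qed

lemma Ck_on_linear:
  assumes "bounded_linear h" "open S" "Ck_on k S f"
  shows "Ck_on k S (\<lambda>x. h (f x))"
proof -
  \<comment> \<open>A linear map is treated as a bilinear one whose first argument is the constant
    1, which saves a second induction.\<close>
  have "bounded_bilinear (\<lambda>(c::real) y. c *\<^sub>R h y)"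
    using bounded_bilinear.comp[OF bounded_bilinear_scaleR bounded_linear_ident assms(1)] .
  from Ck_on_bilinear[OF this assms(2) Ck_on_const[of k S 1] assms(3)] show ?thesis by simp
qed

lemma smooth_on_bilinear:
  "bounded_bilinear h \<Longrightarrow> open S \<Longrightarrow> smooth_on S f \<Longrightarrow> smooth_on S g \<Longrightarrow>
    smooth_on S (\<lambda>x. h (f x) (g x))"
  by (simp add: smooth_on_def Ck_on_bilinear)

lemma smooth_on_linear:
  "bounded_linear h \<Longrightarrow> open S \<Longrightarrow> smooth_on S f \<Longrightarrow> smooth_on S (\<lambda>x. h (f x))"
  by (simp add: smooth_on_def Ck_on_linear)

lemma smooth_on_sum:
  assumes "open S" "\<And>i. i \<in> I \<Longrightarrow> smooth_on S (f i)"
  shows "smooth_on S (\<lambda>x. \<Sum>i\<in>I. f i x)"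
  using assms(2)
  by (induction I rule: infinite_finite_induct)
    (auto simp: smooth_on_def Ck_on_const intro!: Ck_on_add[OF assms(1)])

lemma smooth_on_differentiable: "smooth_on S f \<Longrightarrow> x \<in> S \<Longrightarrow> f differentiable (at x)"
  unfolding smooth_on_def using Ck_on.simps(2)[of 0 S f] by blast

lemma smooth_on_frechet: "smooth_on S f \<Longrightarrow> smooth_on S (\<lambda>x. frechet_derivative f (at x) v)"
  unfolding smooth_on_def using Ck_on.simps(2)[of _ S f] by blast

section \<open>Symmetry of mixed second derivatives\<close>

lemma has_real_derivative_along_line:
  fixes f :: "'a::euclidean_space \<Rightarrow> real"
  assumes "f differentiable (at (x + s *\<^sub>R v))"
  shows "((\<lambda>s. f (x + s *\<^sub>R v)) has_real_derivative frechet_derivative f (at (x + s *\<^sub>R v)) v) (at s)"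
proof -
  let ?f' = "frechet_derivative f (at (x + s *\<^sub>R v))"
  have f: "(f has_derivative ?f') (at (x + s *\<^sub>R v))"
    using assms by (simp flip: frechet_derivative_works)
  have "((\<lambda>s. x + s *\<^sub>R v) has_derivative (\<lambda>t. t *\<^sub>R v)) (at s)"
    by (auto intro!: derivative_eq_intros)
  from diff_chain_at[OF this f] have "((\<lambda>s. f (x + s *\<^sub>R v)) has_derivative (\<lambda>t. ?f' (t *\<^sub>R v))) (at s)"
    by (simp add: o_def)
  then show ?thesis
    by (simp add: has_field_derivative_def linear_scale[OF linear_frechet_derivative[OF assms]]
        mult_commute_abs)
qed

text \<open>The mean value theorem is applied twice: along \<open>u\<close> to the increment
  \<open>?g\<close> in direction \<open>v\<close>, then along \<open>v\<close> to the derivative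
  \<open>?fu\<close>.\<close>

lemma second_difference_mean_value:
  fixes f :: "'a::euclidean_space \<Rightarrow> real"
  assumes "Ck_on 2 S f" "0 < h"
    and sub: "\<And>s t. 0 \<le> s \<Longrightarrow> s \<le> h \<Longrightarrow> 0 \<le> t \<Longrightarrow> t \<le> h \<Longrightarrow> x + s *\<^sub>R u + t *\<^sub>R v \<in> S"
  obtains s t where "0 \<le> s" "s \<le> h" "0 \<le> t" "t \<le> h"
    "f (x + h *\<^sub>R u + h *\<^sub>R v) - f (x + h *\<^sub>R u) - f (x + h *\<^sub>R v) + f x =
      h * h * frechet_derivative (\<lambda>y. frechet_derivative f (at y) u) (at (x + s *\<^sub>R u + t *\<^sub>R v)) v"
proof -
  let ?fu = "\<lambda>y. frechet_derivative f (at y) u"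
  let ?g = "\<lambda>s. f (x + h *\<^sub>R v + s *\<^sub>R u) - f (x + s *\<^sub>R u)"
  have C: "Ck_on (Suc (Suc 0)) S f"
    using assms(1) by (simp add: numeral_2_eq_2 del: Ck_on.simps)
  then have d1: "f differentiable (at y)" and d2: "?fu differentiable (at y)" if "y \<in> S" for y
    using that by auto
  have "\<exists>s>0. s < h \<and> ?g h - ?g 0 = (h - 0) * (?fu (x + h *\<^sub>R v + s *\<^sub>R u) - ?fu (x + s *\<^sub>R u))"
  proof (rule MVT2[OF assms(2)])
    fix s assume "0 \<le> s" "s \<le> h"
    with sub[of s h] sub[of s 0] assms(2)
    have "x + h *\<^sub>R v + s *\<^sub>R u \<in> S" "x + s *\<^sub>R u \<in> S" by (simp_all add: algebra_simps)
    then show "(?g has_real_derivative ?fu (x + h *\<^sub>R v + s *\<^sub>R u) - ?fu (x + s *\<^sub>R u)) (at s)"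
      by (intro DERIV_diff has_real_derivative_along_line d1)
  qed
  then obtain s where s: "0 < s" "s < h"
    "?g h - ?g 0 = h * (?fu (x + s *\<^sub>R u + h *\<^sub>R v) - ?fu (x + s *\<^sub>R u + 0 *\<^sub>R v))"
    by (auto simp: algebra_simps)
  have "\<exists>t>0. t < h \<and> ?fu (x + s *\<^sub>R u + h *\<^sub>R v) - ?fu (x + s *\<^sub>R u + 0 *\<^sub>R v) =
      (h - 0) * frechet_derivative ?fu (at (x + s *\<^sub>R u + t *\<^sub>R v)) v"
    using s sub by (intro MVT2[OF assms(2)] has_real_derivative_along_line d2) auto
  then obtain t where "0 < t" "t < h"
    "?fu (x + s *\<^sub>R u + h *\<^sub>R v) - ?fu (x + s *\<^sub>R u + 0 *\<^sub>R v) =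
      h * frechet_derivative ?fu (at (x + s *\<^sub>R u + t *\<^sub>R v)) v"
    by auto
  with s show thesis by (intro that[of s t]) (auto simp: algebra_simps)
qed

text \<open>The second difference over a parallelogram is symmetric in \<open>u\<close> and
  \<open>v\<close>, so both mixed derivatives attain the same value near \<open>x\<close>. If they
  differed at \<open>x\<close>, continuity would contradict this on a small enough
  parallelogram.\<close>

lemma second_derivative_symmetric_real:
  fixes f :: "'a::euclidean_space \<Rightarrow> real"
  assumes "open S" "Ck_on 2 S f" "x \<in> S"
  shows "frechet_derivative (\<lambda>y. frechet_derivative f (at y) u) (at x) v =
         frechet_derivative (\<lambda>y. frechet_derivative f (at y) v) (at x) u" (is "?A u v x = ?A v u x")
proof (rule ccontr)
  assume "?A u v x \<noteq> ?A v u x"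
  define \<epsilon> where "\<epsilon> = \<bar>?A u v x - ?A v u x\<bar> / 2"
  have "\<epsilon> > 0" using \<open>?A u v x \<noteq> ?A v u x\<close> by (simp add: \<epsilon>_def)
  have C: "Ck_on (Suc (Suc 0)) S f"
    using assms(2) by (simp add: numeral_2_eq_2 del: Ck_on.simps)
  have near: "\<exists>d>0. \<forall>y. dist y x < d \<longrightarrow> \<bar>?A p q y - ?A p q x\<bar> < \<epsilon>" for p q
  proof -
    have "continuous_on S (?A p q)" using C by simp
    then have "continuous (at x) (?A p q)"
      using assms continuous_on_eq_continuous_at by blast
    then show ?thesis using \<open>\<epsilon> > 0\<close> unfolding continuous_at_eps_delta dist_real_def by blast
  qed
  obtain d1 where d1: "d1 > 0" "\<And>y. dist y x < d1 \<Longrightarrow> \<bar>?A u v y - ?A u v x\<bar> < \<epsilon>"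
    using near by blast
  obtain d2 where d2: "d2 > 0" "\<And>y. dist y x < d2 \<Longrightarrow> \<bar>?A v u y - ?A v u x\<bar> < \<epsilon>"
    using near by blast
  obtain d3 where d3: "d3 > 0" "\<And>y. dist y x < d3 \<Longrightarrow> y \<in> S"
    using assms unfolding open_dist by blast
  define d where "d = min d1 (min d2 d3)"
  \<comment> \<open>This size keeps the whole parallelogram within distance \<open>d\<close> of
    \<open>x\<close>; the summand 1 keeps the denominator positive when \<open>u\<close> and
    \<open>v\<close> are both zero.\<close>
  define h where "h = d / (2 * (norm u + norm v + 1))"
  have pos: "norm u + norm v + 1 > 0" by (simp add: add_nonneg_pos)
  have "d > 0" using d1 d2 d3 by (simp add: d_def)
  then have "h > 0" using pos by (simp add: h_def)
  have close: "dist (x + s *\<^sub>R u + t *\<^sub>R v) x < d"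
    if "0 \<le> s" "s \<le> h" "0 \<le> t" "t \<le> h" for s t
  proof -
    have "dist (x + s *\<^sub>R u + t *\<^sub>R v) x \<le> s * norm u + t * norm v"
      using norm_triangle_ineq[of "s *\<^sub>R u" "t *\<^sub>R v"] that by (simp add: dist_norm algebra_simps)
    also have "\<dots> \<le> h * norm u + h * norm v"
      using that by (intro add_mono mult_right_mono) auto
    also have "\<dots> < h * (2 * (norm u + norm v + 1))"
    proof -
      have "0 \<le> h * norm u" "0 \<le> h * norm v" using \<open>h > 0\<close> by simp_all
      then show ?thesis using \<open>h > 0\<close> by (simp add: distrib_left add_nonneg_pos)
    qed
    also have "\<dots> = d" using pos by (simp add: h_def)
    finally show ?thesis .
  qed
  let ?\<Delta> = "f (x + h *\<^sub>R u + h *\<^sub>R v) - f (x + h *\<^sub>R u) - f (x + h *\<^sub>R v) + f x"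
  have sub: "x + s *\<^sub>R u + t *\<^sub>R v \<in> S" if "0 \<le> s" "s \<le> h" "0 \<le> t" "t \<le> h" for s t
    using d3(2) close[OF that] by (simp add: d_def)
  have sub': "x + s *\<^sub>R v + t *\<^sub>R u \<in> S" if "0 \<le> s" "s \<le> h" "0 \<le> t" "t \<le> h" for s t
    using sub[of t s] that by (simp add: algebra_simps)
  obtain s t where st: "0 \<le> s" "s \<le> h" "0 \<le> t" "t \<le> h"
    "?\<Delta> = h * h * ?A u v (x + s *\<^sub>R u + t *\<^sub>R v)"
    by (rule second_difference_mean_value[OF assms(2) \<open>h > 0\<close> sub])
  obtain s' t' where st': "0 \<le> s'" "s' \<le> h" "0 \<le> t'" "t' \<le> h"
    "f (x + h *\<^sub>R v + h *\<^sub>R u) - f (x + h *\<^sub>R v) - f (x + h *\<^sub>R u) + f x =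
      h * h * ?A v u (x + s' *\<^sub>R v + t' *\<^sub>R u)"
    by (rule second_difference_mean_value[OF assms(2) \<open>h > 0\<close> sub'])
  have eq: "?A u v (x + s *\<^sub>R u + t *\<^sub>R v) = ?A v u (x + t' *\<^sub>R u + s' *\<^sub>R v)"
  proof -
    have "h * h * ?A u v (x + s *\<^sub>R u + t *\<^sub>R v) = h * h * ?A v u (x + s' *\<^sub>R v + t' *\<^sub>R u)"
      using st(5) st'(5) by (simp add: algebra_simps)
    then have "?A u v (x + s *\<^sub>R u + t *\<^sub>R v) = ?A v u (x + s' *\<^sub>R v + t' *\<^sub>R u)"
      using \<open>h > 0\<close> by simp
    then show ?thesis by (simp add: add_ac)
  qed
  have "\<bar>?A u v (x + s *\<^sub>R u + t *\<^sub>R v) - ?A u v x\<bar> < \<epsilon>"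
    using close[OF st(1-4)] by (intro d1(2)) (simp add: d_def)
  moreover have "\<bar>?A v u (x + t' *\<^sub>R u + s' *\<^sub>R v) - ?A v u x\<bar> < \<epsilon>"
    using close[OF st'(3,4,1,2)] by (intro d2(2)) (simp add: d_def)
  \<comment> \<open>The common value lies strictly within half the gap of both
    \<open>?A u v x\<close> and \<open>?A v u x\<close>.\<close>
  ultimately show False unfolding eq \<epsilon>_def by argo
qed

section \<open>Coordinate derivatives\<close>

text \<open>Unlike \<open>partial_deriv\<close>, this also applies to vector-valued maps such as
  \<open>X j\<close>, \<open>e k\<close> and the frame fields.\<close>

definition coord_deriv :: "'n::finite \<Rightarrow> (real^'n \<Rightarrow> 'b::euclidean_space) \<Rightarrow> real^'n \<Rightarrow> 'b" where
  "coord_deriv i f x = frechet_derivative f (at x) (axis i 1)"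

lemma partial_deriv_eq_coord_deriv: "partial_deriv = coord_deriv"
  by (simp add: fun_eq_iff partial_deriv_def coord_deriv_def)

lemma smooth_on_coord_deriv: "smooth_on S f \<Longrightarrow> smooth_on S (coord_deriv i f)"
  unfolding coord_deriv_def by (rule smooth_on_frechet)

lemma coord_deriv_cong:
  assumes "open S" "x \<in> S" "smooth_on S f" "\<And>y. y \<in> S \<Longrightarrow> f y = g y"
  shows "coord_deriv i f x = coord_deriv i g x"
  using frechet_derivative_transform_within_open[OF smooth_on_differentiable[OF assms(3,2)] assms(1,2)]
    assms(4) by (simp add: coord_deriv_def)

lemma coord_deriv_const [simp]: "coord_deriv i (\<lambda>x. c) x = 0"
  by (simp add: coord_deriv_def)

lemma coord_deriv_bilinear:
  assumes "bounded_bilinear h" "smooth_on S f" "smooth_on S g" "x \<in> S"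
  shows "coord_deriv i (\<lambda>x. h (f x) (g x)) x = h (f x) (coord_deriv i g x) + h (coord_deriv i f x) (g x)"
proof -
  have "(f has_derivative frechet_derivative f (at x)) (at x)"
    "(g has_derivative frechet_derivative g (at x)) (at x)"
    using smooth_on_differentiable assms by (auto simp flip: frechet_derivative_works)
  from fun_cong[OF frechet_derivative_at[OF bounded_bilinear.FDERIV[OF assms(1) this]]] show ?thesis
    unfolding coord_deriv_def by (rule sym)
qed

lemmas coord_deriv_scaleR = coord_deriv_bilinear[OF bounded_bilinear_scaleR]
lemmas coord_deriv_inner = coord_deriv_bilinear[OF bounded_bilinear_inner]
lemmas coord_deriv_mult = coord_deriv_bilinear[OF bounded_bilinear_mult]

lemma coord_deriv_sum:
  assumes "\<And>j. j \<in> I \<Longrightarrow> smooth_on S (f j)" "x \<in> S"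
  shows "coord_deriv i (\<lambda>x. \<Sum>j\<in>I. f j x) x = (\<Sum>j\<in>I. coord_deriv i (f j) x)"
proof -
  have "((\<lambda>x. \<Sum>j\<in>I. f j x) has_derivative (\<lambda>v. \<Sum>j\<in>I. frechet_derivative (f j) (at x) v)) (at x)"
    using smooth_on_differentiable assms
    by (intro has_derivative_sum) (auto simp flip: frechet_derivative_works)
  from fun_cong[OF frechet_derivative_at[OF this]] show ?thesis
    unfolding coord_deriv_def by (rule sym)
qed

lemma coord_deriv_linear:
  assumes "bounded_linear h" "smooth_on S f" "x \<in> S"
  shows "coord_deriv i (\<lambda>x. h (f x)) x = h (coord_deriv i f x)"
proof -
  have "(f has_derivative frechet_derivative f (at x)) (at x)"
    using smooth_on_differentiable assms by (auto simp flip: frechet_derivative_works)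
  from fun_cong[OF frechet_derivative_at[OF bounded_linear.has_derivative[OF assms(1) this]]]
  show ?thesis unfolding coord_deriv_def by (rule sym)
qed

text \<open>Pairing with a fixed vector \<open>w\<close> reduces the claim to real functions;
  choosing \<open>w\<close> as the difference of the two sides shows that this difference is
  zero.\<close>

lemma coord_deriv_commute:
  assumes "open S" "smooth_on S f" "x \<in> S"
  shows "coord_deriv i (coord_deriv j f) x = coord_deriv j (coord_deriv i f) x"
proof (rule inner_eq_zero_iff[THEN iffD1, THEN right_minus_eq[THEN iffD1]])
  have "coord_deriv i (coord_deriv j f) x \<bullet> w = coord_deriv j (coord_deriv i f) x \<bullet> w" for w
  proof -
    have lin: "bounded_linear (\<lambda>y. y \<bullet> w)" by (rule bounded_linear_inner_left)
    define g where "g = (\<lambda>y. f y \<bullet> w)"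
    have g: "smooth_on S g" unfolding g_def by (rule smooth_on_linear[OF lin assms(1,2)])
    have *: "coord_deriv k (coord_deriv l f) x \<bullet> w = coord_deriv k (coord_deriv l g) x" for k l
    proof -
      have "coord_deriv k (coord_deriv l g) x = coord_deriv k (\<lambda>y. coord_deriv l f y \<bullet> w) x"
        using smooth_on_coord_deriv[OF g] coord_deriv_linear[OF lin assms(2)]
        by (intro coord_deriv_cong[OF assms(1,3)]) (auto simp: g_def)
      also have "\<dots> = coord_deriv k (coord_deriv l f) x \<bullet> w"
        by (rule coord_deriv_linear[OF lin smooth_on_coord_deriv[OF assms(2)] assms(3)])
      finally show ?thesis by simp
    qed
    have "coord_deriv i (coord_deriv j g) x = coord_deriv j (coord_deriv i g) x"
      using second_derivative_symmetric_real[OF assms(1) _ assms(3)] g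
      unfolding coord_deriv_def smooth_on_def by blast
    then show ?thesis by (simp add: *)
  qed
  then show "(coord_deriv i (coord_deriv j f) x - coord_deriv j (coord_deriv i f) x) \<bullet>
      (coord_deriv i (coord_deriv j f) x - coord_deriv j (coord_deriv i f) x) = 0"
    by (simp add: inner_diff_left)
qed

section \<open>Orthonormal frames\<close>

text \<open>The \<open>u i\<close> and \<open>e k\<close> are indexed together by the coordinate
  type \<open>'n + 'p\<close> itself, so as rows they form a square orthogonal matrix, which
  preserves inner products. In particular, a vector orthogonal to the whole frame vanishes.\<close>

lemma inner_orthonormal_frame:
  fixes u :: "'n::finite \<Rightarrow> real^('n + 'p::finite)" and e :: "'p \<Rightarrow> real^('n + 'p)"
  assumes u: "\<And>i j. u i \<bullet> u j = (if i = j then 1 else 0)"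
    and e: "\<And>k l. e k \<bullet> e l = (if k = l then 1 else 0)"
    and ue: "\<And>i k. u i \<bullet> e k = 0"
  shows "v \<bullet> w = (\<Sum>i\<in>UNIV. (v \<bullet> u i) * (w \<bullet> u i)) + (\<Sum>k\<in>UNIV. (v \<bullet> e k) * (w \<bullet> e k))"
proof -
  define P :: "real^('n + 'p)^('n + 'p)" where "P = (\<chi> s. case_sum u e s)"
  have P: "P $ s = case_sum u e s" for s by (simp add: P_def)
  have "orthogonal_matrix P"
    unfolding orthogonal_matrix_orthonormal_rows
    using u e ue by (auto simp: row_def P norm_eq_1 orthogonal_def inner_commute vec_nth_inverse
        split: sum.splits)
  then have "v \<bullet> w = (P *v v) \<bullet> (P *v w)"
    using orthogonal_transformation_matrix[of "(*v) P"]
    by (simp add: orthogonal_transformation_def)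
  also have "\<dots> = (\<Sum>s\<in>UNIV. (v \<bullet> case_sum u e s) * (w \<bullet> case_sum u e s))"
    by (simp add: inner_vec_def[of "P *v v"] matrix_vector_mul_component P inner_commute)
  also have "\<dots> = (\<Sum>i\<in>UNIV. (v \<bullet> u i) * (w \<bullet> u i)) + (\<Sum>k\<in>UNIV. (v \<bullet> e k) * (w \<bullet> e k))"
    by (simp add: UNIV_Plus_UNIV[symmetric] sum.Plus del: UNIV_Plus_UNIV)
  finally show ?thesis .
qed

text \<open>The variational inequality for the nearest point, applied to \<open>w\<close> and to
  \<open>- w\<close>, bounds the inner product from both sides. It turns vanishing of
  \<open>normal_conn\<close> into tangency of the derivative.\<close>

lemma closest_point_subspace_eq_0_imp_orthogonal:
  fixes S :: "'a::euclidean_space set"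
  assumes "subspace S" "closest_point S v = 0" "w \<in> S"
  shows "v \<bullet> w = 0"
proof -
  have "convex S" "closed S"
    using assms(1) by (auto intro: subspace_imp_convex closed_subspace)
  from closest_point_dot[OF this assms(3), of v]
    closest_point_dot[OF this subspace_neg[OF assms(1,3)], of v] assms(2)
  show ?thesis by simp
qed

lemma subspace_normal_space: "subspace (normal_space X x)"
  by (auto simp: subspace_def normal_space_def orthogonal_def inner_simps)

section \<open>Integrability conditions of an adapted frame\<close>

text \<open>Once the structure equations \<open>dX\<close>, \<open>de\<close> and \<open>du\<close>
  hold for an orthonormal frame, the differential equations of the system are their compatibility
  conditions.\<close>

lemma solves_system_II_of_frame:
  fixes D :: "(real^'n::finite) set"
    and u :: "'n \<Rightarrow> real^'n \<Rightarrow> real^('n + 'p::finite)"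
    and e :: "'p \<Rightarrow> real^'n \<Rightarrow> real^('n + 'p)"
    and X :: "'n \<Rightarrow> real^'n \<Rightarrow> real^('n + 'p)"
    and B F :: "real^'n \<Rightarrow> real^'n^'n"
    and G :: "real^'n \<Rightarrow> real^'n^'p"
  assumes D: "open D"
    and smooth: "\<And>i. smooth_on D (u i)" "\<And>k. smooth_on D (e k)" "\<And>j. smooth_on D (X j)"
      "smooth_on D B" "smooth_on D F" "smooth_on D G"
    and uu: "\<And>x i j. x \<in> D \<Longrightarrow> u i x \<bullet> u j x = (if i = j then 1 else 0)"
    and ee: "\<And>x k l. x \<in> D \<Longrightarrow> e k x \<bullet> e l x = (if k = l then 1 else 0)"
    and ue: "\<And>x i k. x \<in> D \<Longrightarrow> u i x \<bullet> e k x = 0"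
    and dX: "\<And>x i j. x \<in> D \<Longrightarrow> coord_deriv i (X j) x = B x $ j $ i *\<^sub>R u i x"
    and de: "\<And>x i k. x \<in> D \<Longrightarrow> coord_deriv i (e k) x = G x $ k $ i *\<^sub>R u i x"
    and du: "\<And>x i j. x \<in> D \<Longrightarrow> i \<noteq> j \<Longrightarrow> coord_deriv j (u i) x = F x $ i $ j *\<^sub>R u j x"
    and F0: "\<And>x i. x \<in> D \<Longrightarrow> F x $ i $ i = 0"
    and B: "\<And>x. x \<in> D \<Longrightarrow> orthogonal_matrix (B x)"
  shows "solves_system_II D F G B"
proof -
  have entry: "smooth_on D (\<lambda>x. M x $ i $ j)" if "smooth_on D M"
    for M :: "real^'n \<Rightarrow> real^'n^'q::finite" and i j
    using smooth_on_linear[OF bounded_linear_vec_nth[of j] D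
        smooth_on_linear[OF bounded_linear_vec_nth[of i] D that]] .
  have u_du: "coord_deriv j (u i) x \<bullet> u i x = 0" if "x \<in> D" for x i j
  proof -
    have "coord_deriv j (\<lambda>y. u i y \<bullet> u i y) x = coord_deriv j (\<lambda>y. 1) x"
      by (intro coord_deriv_cong[OF D that] smooth_on_bilinear[OF bounded_bilinear_inner] D smooth)
        (simp add: uu)
    then show ?thesis
      by (simp add: coord_deriv_inner[OF smooth(1) smooth(1) that] inner_commute)
  qed
  \<comment> \<open>Stated for a general map \<open>Y\<close> so that \<open>Y = X j\<close> with a
    row of \<open>B\<close> and \<open>Y = e k\<close> with a row of \<open>G\<close> give both
    linear families of the system. In the \<open>u l\<close> component of the mixed partials,
    \<open>u_du\<close> and \<open>du\<close> leave one term on each side.\<close>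
  have potential: "coord_deriv m (h l) x = F x $ m $ l * h m x"
    if Y: "smooth_on D Y" "\<And>x i. x \<in> D \<Longrightarrow> coord_deriv i Y x = h i x *\<^sub>R u i x"
      and h: "\<And>i. smooth_on D (h i)" and "x \<in> D" "l \<noteq> m"
    for Y :: "real^'n \<Rightarrow> real^('n + 'p)" and h x l m
  proof -
    have *: "coord_deriv i (coord_deriv j Y) x =
        h j x *\<^sub>R coord_deriv i (u j) x + coord_deriv i (h j) x *\<^sub>R u j x" for i j
    proof -
      have "coord_deriv i (coord_deriv j Y) x = coord_deriv i (\<lambda>y. h j y *\<^sub>R u j y) x"
        by (intro coord_deriv_cong[OF D \<open>x \<in> D\<close>] smooth_on_coord_deriv Y)
      also have "\<dots> = h j x *\<^sub>R coord_deriv i (u j) x + coord_deriv i (h j) x *\<^sub>R u j x"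
        by (rule coord_deriv_scaleR[OF h smooth(1) \<open>x \<in> D\<close>])
      finally show ?thesis .
    qed
    have "coord_deriv m (coord_deriv l Y) x \<bullet> u l x = coord_deriv l (coord_deriv m Y) x \<bullet> u l x"
      by (simp add: coord_deriv_commute[OF D Y(1) \<open>x \<in> D\<close>])
    then show ?thesis
      unfolding * using \<open>x \<in> D\<close> \<open>l \<noteq> m\<close> by (simp add: inner_add_left u_du uu du)
  qed
  have ddu: "coord_deriv k (coord_deriv j (u i)) x =
      F x $ i $ j *\<^sub>R coord_deriv k (u j) x + coord_deriv k (\<lambda>y. F y $ i $ j) x *\<^sub>R u j x"
    if "x \<in> D" "i \<noteq> j" for x i j k
  proof -
    have "coord_deriv k (coord_deriv j (u i)) x = coord_deriv k (\<lambda>y. F y $ i $ j *\<^sub>R u j y) x"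
      using that by (intro coord_deriv_cong[OF D \<open>x \<in> D\<close>] smooth_on_coord_deriv smooth du)
    also have "\<dots> = F x $ i $ j *\<^sub>R coord_deriv k (u j) x + coord_deriv k (\<lambda>y. F y $ i $ j) x *\<^sub>R u j x"
      by (rule coord_deriv_scaleR[OF entry[OF smooth(5)] smooth(1) \<open>x \<in> D\<close>])
    finally show ?thesis .
  qed
  \<comment> \<open>This is the \<open>u j\<close> component of the equality of the mixed partials
    of \<open>u i\<close>.\<close>
  have F_deriv: "coord_deriv k (\<lambda>y. F y $ i $ j) x = F x $ i $ k * F x $ k $ j"
    if "x \<in> D" "i \<noteq> j" "j \<noteq> k" "i \<noteq> k" for x i j k
  proof -
    have "coord_deriv k (coord_deriv j (u i)) x \<bullet> u j x = coord_deriv j (coord_deriv k (u i)) x \<bullet> u j x"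
      by (simp add: coord_deriv_commute[OF D smooth(1) \<open>x \<in> D\<close>])
    then show ?thesis
      using that by (simp add: ddu inner_add_left du uu)
  qed
  \<comment> \<open>\<open>du\<close> says nothing about \<open>coord_deriv i (u i)\<close>; its
    components come from differentiating the orthogonality relations. Including \<open>i = j\<close>
    lets the later sum range over all indices.\<close>
  have diag_u: "coord_deriv i (u i) x \<bullet> u j x = - F x $ j $ i" if "x \<in> D" for x i j
  proof (cases "i = j")
    case True
    then show ?thesis using that by (simp add: u_du F0)
  next
    case False
    have "coord_deriv i (\<lambda>y. u i y \<bullet> u j y) x = coord_deriv i (\<lambda>y. 0) x"
      by (intro coord_deriv_cong[OF D that] smooth_on_bilinear[OF bounded_bilinear_inner] D smooth)
        (simp add: uu False)
    then show ?thesis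
      using that False by (simp add: coord_deriv_inner[OF smooth(1) smooth(1) that] du uu)
  qed
  have diag_e: "coord_deriv i (u i) x \<bullet> e k x = - G x $ k $ i" if "x \<in> D" for x i k
  proof -
    have "coord_deriv i (\<lambda>y. u i y \<bullet> e k y) x = coord_deriv i (\<lambda>y. 0) x"
      by (intro coord_deriv_cong[OF D that] smooth_on_bilinear[OF bounded_bilinear_inner] D smooth)
        (simp add: ue)
    then show ?thesis
      using that by (simp add: coord_deriv_inner[OF smooth(1) smooth(2) that] de uu)
  qed
  \<comment> \<open>Differentiate \<open>diag_u\<close> in direction \<open>j\<close> and commute
    the derivatives of \<open>u i\<close>. The remaining inner product of the two diagonal
    derivatives expands in the frame, where the minus signs cancel in pairs.\<close>
  have gauss: "coord_deriv i (\<lambda>y. F y $ i $ j) x + coord_deriv j (\<lambda>y. F y $ j $ i) x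
      + (\<Sum>k\<in>UNIV. F x $ k $ i * F x $ k $ j) + (\<Sum>k\<in>UNIV. G x $ k $ i * G x $ k $ j) = 0"
    if "x \<in> D" "i \<noteq> j" for x i j
  proof -
    have "coord_deriv j (\<lambda>y. coord_deriv i (u i) y \<bullet> u j y) x = coord_deriv j (\<lambda>y. - F y $ j $ i) x"
      by (intro coord_deriv_cong[OF D \<open>x \<in> D\<close>] smooth_on_bilinear[OF bounded_bilinear_inner] D
          smooth smooth_on_coord_deriv diag_u)
    also have "\<dots> = - coord_deriv j (\<lambda>y. F y $ j $ i) x"
      by (rule coord_deriv_linear[OF bounded_linear_minus[OF bounded_linear_ident] entry[OF smooth(5)] \<open>x \<in> D\<close>])
    finally have "coord_deriv j (coord_deriv i (u i)) x \<bullet> u j x =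
        - coord_deriv j (\<lambda>y. F y $ j $ i) x - coord_deriv i (u i) x \<bullet> coord_deriv j (u j) x"
      by (simp add: coord_deriv_inner[OF smooth_on_coord_deriv[OF smooth(1)] smooth(1) \<open>x \<in> D\<close>])
    moreover have "coord_deriv j (coord_deriv i (u i)) x \<bullet> u j x = coord_deriv i (\<lambda>y. F y $ i $ j) x"
      using that
      by (simp add: coord_deriv_commute[OF D smooth(1) \<open>x \<in> D\<close>, of j] ddu inner_add_left uu u_du)
    moreover have "coord_deriv i (u i) x \<bullet> coord_deriv j (u j) x =
        (\<Sum>k\<in>UNIV. F x $ k $ i * F x $ k $ j) + (\<Sum>k\<in>UNIV. G x $ k $ i * G x $ k $ j)"
      using that inner_orthonormal_frame[of "\<lambda>i. u i x" "\<lambda>k. e k x"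
          "coord_deriv i (u i) x" "coord_deriv j (u j) x"]
      by (simp add: uu ee ue diag_u diag_e)
    ultimately show ?thesis by simp
  qed
  show ?thesis
    unfolding solves_system_II_def partial_deriv_eq_coord_deriv
    using smooth(4-6) B F0 gauss F_deriv
      potential[OF smooth(3) dX entry[OF smooth(4)]]
      potential[OF smooth(2) de entry[OF smooth(6)]] by blast
qed

section \<open>The common tangent frame\<close>

text \<open>The two forms are evaluated on coordinate vectors. Parallelism makes the derivatives of
  \<open>e k\<close> tangential, so their inner products with the \<open>coord_deriv j X x\<close>
  determine them. The last relation is kept free of denominators.\<close>

lemma coord_deriv_orthonormal_tangent:
  fixes X :: "real^'n::finite \<Rightarrow> real^('n + 'p::finite)"
    and e :: "'p \<Rightarrow> real^'n \<Rightarrow> real^('n + 'p)"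
  assumes imm: "immersion_on D X" and frame: "parallel_normal_frame D X e"
    and coords: "line_of_curvature_coords D X e a (\<lambda>x. \<chi> k i. a x $ i * G x $ k $ i)"
    and x: "x \<in> D"
  shows "a x $ i \<noteq> 0"
    and "coord_deriv i X x \<bullet> coord_deriv j X x = (if i = j then (a x $ i)\<^sup>2 else 0)"
    and "coord_deriv i X x \<bullet> e k x = 0"
    and "a x $ i *\<^sub>R coord_deriv i (e k) x = G x $ k $ i *\<^sub>R coord_deriv i X x"
proof -
  show tangent: "coord_deriv i X x \<bullet> coord_deriv j X x = (if i = j then (a x $ i)\<^sup>2 else 0)" for i j
  proof -
    have "first_form X x (axis i 1) (axis j 1) =
        (\<Sum>l\<in>UNIV. (a x $ l)\<^sup>2 * (axis i 1 $ l * axis j 1 $ l))"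
      using coords x by (simp add: line_of_curvature_coords_def)
    also have "\<dots> = (\<Sum>l\<in>UNIV. if l = i then (if i = j then (a x $ i)\<^sup>2 else 0) else 0)"
      by (rule sum.cong) (auto simp: axis_def)
    finally show ?thesis by (simp add: first_form_def coord_deriv_def)
  qed
  have "X differentiable (at x)"
    using imm x by (auto simp: immersion_on_def intro: smooth_on_differentiable)
  then have "linear (frechet_derivative X (at x))"
    by (rule linear_frechet_derivative)
  moreover have "inj (frechet_derivative X (at x))"
    using imm x by (simp add: immersion_on_def)
  ultimately have "coord_deriv i X x \<noteq> 0" for i
    unfolding coord_deriv_def using linear_injective_0 axis_eq_0_iff zero_neq_one by metis
  then show a0: "a x $ i \<noteq> 0" for i
    using tangent[of i i] by auto
  have e: "smooth_on D (e k)" "e k x \<in> normal_space X x" "e k x \<bullet> e l x = (if k = l then 1 else 0)"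
    "normal_conn X (e k) x v = 0" for k l v
    using frame x by (auto simp: parallel_normal_frame_def normal_field_on_def)
  show normal: "coord_deriv i X x \<bullet> e k x = 0" for i k
    using e(2)[of k] by (simp add: normal_space_def orthogonal_def coord_deriv_def inner_commute)
  have de_normal: "coord_deriv i (e k) x \<bullet> e l x = 0" for i k l
    using closest_point_subspace_eq_0_imp_orthogonal[OF subspace_normal_space _ e(2)] e(4)
    by (simp add: normal_conn_def coord_deriv_def)
  \<comment> \<open>Pairing the second form with \<open>e k x\<close> extracts its
    \<open>k\<close>-th coefficient, by orthonormality of the normal frame.\<close>
  have de: "coord_deriv j X x \<bullet> coord_deriv i (e k) x = (if i = j then a x $ i * G x $ k $ i else 0)"
    for i j k
  proof -
    have "(\<Sum>l\<in>UNIV. (coord_deriv j X x \<bullet> coord_deriv i (e l) x) *\<^sub>R e l x) =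
        (\<Sum>r\<in>UNIV. \<Sum>l\<in>UNIV. (a x $ r * G x $ l $ r * (axis j 1 $ r * axis i 1 $ r)) *\<^sub>R e l x)"
      using coords x by (simp add: line_of_curvature_coords_def second_form_def coord_deriv_def)
    from arg_cong[OF this, of "\<lambda>v. v \<bullet> e k x"]
    have "coord_deriv j X x \<bullet> coord_deriv i (e k) x =
        (\<Sum>r\<in>UNIV. a x $ r * G x $ k $ r * (axis j 1 $ r * axis i 1 $ r))"
      by (simp add: inner_sum_left e(3) if_distrib cong: if_cong)
    also have "\<dots> = (\<Sum>r\<in>UNIV. if r = i then (if i = j then a x $ i * G x $ k $ i else 0) else 0)"
      by (rule sum.cong) (auto simp: axis_def)
    finally show ?thesis by simp
  qed
  define t where "t i = (1 / a x $ i) *\<^sub>R coord_deriv i X x" for i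
  have t: "t i \<bullet> t j = (if i = j then 1 else 0)" "t i \<bullet> e k x = 0" for i j k
    using a0[of i] a0[of j] by (auto simp: t_def tangent normal power2_eq_square)
  \<comment> \<open>\<open>w\<close> is orthogonal to the whole frame \<open>t\<close>, \<open>e\<close>.\<close>
  define w where "w = a x $ i *\<^sub>R coord_deriv i (e k) x - G x $ k $ i *\<^sub>R coord_deriv i X x"
  have "w \<bullet> t j = 0" for j
    using a0[of i] a0[of j]
    by (auto simp: w_def t_def inner_diff_left tangent de inner_commute[of "coord_deriv i (e k) x"]
        power2_eq_square)
  moreover have "w \<bullet> e l x = 0" for l
    by (simp add: w_def inner_diff_left de_normal normal)
  ultimately have "w \<bullet> w = 0"
    using inner_orthonormal_frame[of t "\<lambda>k. e k x" w w] t e(3) by simp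
  then show "a x $ i *\<^sub>R coord_deriv i (e k) x = G x $ k $ i *\<^sub>R coord_deriv i X x"
    by (simp add: w_def)
qed

section \<open>Smoothness of matrix-valued maps from their entries\<close>

lemma matrix_eq_sum_axis:
  fixes M :: "real^'n::finite^'m::finite"
  shows "M = (\<Sum>i\<in>UNIV. \<Sum>j\<in>UNIV. M $ i $ j *\<^sub>R axis i (axis j 1))"
proof -
  have "(\<Sum>i\<in>UNIV. \<Sum>j\<in>UNIV. M $ i $ j *\<^sub>R axis i (axis j 1)) $ r $ s = M $ r $ s" for r s
  proof -
    have "(\<Sum>i\<in>UNIV. \<Sum>j\<in>UNIV. M $ i $ j *\<^sub>R axis i (axis j 1)) $ r $ s =
        (\<Sum>i\<in>UNIV. \<Sum>j\<in>UNIV. if j = s then (if i = r then M $ r $ s else 0) else 0)"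
      unfolding sum_component by (intro sum.cong) (auto simp: axis_def)
    then show ?thesis by simp
  qed
  then show ?thesis by (simp add: vec_eq_iff)
qed

lemma smooth_on_matrixI:
  fixes M :: "'a::euclidean_space \<Rightarrow> real^'n::finite^'m::finite"
  assumes "open S" "\<And>i j. smooth_on S (\<lambda>x. M x $ i $ j)"
  shows "smooth_on S M"
proof -
  have "smooth_on S (\<lambda>x. \<Sum>i\<in>UNIV. \<Sum>j\<in>UNIV. M x $ i $ j *\<^sub>R axis i (axis j (1::real)))"
    by (intro smooth_on_sum smooth_on_linear[OF bounded_linear_scaleR_left] assms)
  then show ?thesis by (simp flip: matrix_eq_sum_axis)
qed

section \<open>From \<open>n\<close>-tuples to the system\<close>

theorem theorem6p7:
  fixes D :: "(real^'n::finite) set"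
    and X :: "'n \<Rightarrow> real^'n \<Rightarrow> real^('n + 'p::finite)"
    and e :: "'p \<Rightarrow> real^'n \<Rightarrow> real^('n + 'p)"
    and B :: "real^'n \<Rightarrow> real^'n^'n"
    and G :: "real^'n \<Rightarrow> real^'n^'p"
    and F :: "real^'n \<Rightarrow> real^'n^'n"
    and one :: "'n"
  assumes "tuple_of_type_O D X"
    and "common_parallel_normal_frame D X e"
    and "common_spherical_coords D X e B G"
    and "\<And>x i j. x \<in> D \<Longrightarrow> i \<noteq> j \<Longrightarrow>
           F x $ i $ j = partial_deriv i (\<lambda>y. B y $ one $ j) x / B x $ one $ i"
    and "\<And>x i. x \<in> D \<Longrightarrow> F x $ i $ i = 0"
    and "\<And>x k i. x \<in> D \<Longrightarrow> G x $ k $ i \<noteq> 0"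
  shows "solves_system_II D F G B"
proof -
  have D: "open D" and imm: "\<And>j. immersion_on D (X j)"
    using assms(1) by (auto simp: tuple_of_type_O_def is_domain_def)
  have frame: "parallel_normal_frame D (X j) e" for j
    using assms(2) by (simp add: common_parallel_normal_frame_def)
  have coords: "line_of_curvature_coords D (X j) e (\<lambda>x. B x $ j)
      (\<lambda>x. \<chi> k i. B x $ j $ i * G x $ k $ i)" for j
    using assms(3) by (simp add: common_spherical_coords_def spherical_line_of_curvature_coords_def)
  have B: "smooth_on D B" "\<And>x. x \<in> D \<Longrightarrow> orthogonal_matrix (B x)" and G: "smooth_on D G"
    using assms(3) by (auto simp: common_spherical_coords_def)
  have X: "smooth_on D (X j)" for j
    using imm by (simp add: immersion_on_def)
  have e: "smooth_on D (e k)" "x \<in> D \<Longrightarrow> e k x \<bullet> e l x = (if k = l then 1 else 0)" for k l x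
    using frame by (auto simp: parallel_normal_frame_def normal_field_on_def)
  note tangent = coord_deriv_orthonormal_tangent[OF imm frame coords]
  have b: "smooth_on D (\<lambda>x. B x $ j $ i)" for i j
    using smooth_on_linear[OF bounded_linear_vec_nth[of i] D
        smooth_on_linear[OF bounded_linear_vec_nth[of j] D B(1)]] .
  have BB: "(\<Sum>j\<in>UNIV. B x $ j $ i * B x $ j $ l) = (if i = l then 1 else 0)" if "x \<in> D" for x i l
  proof -
    have "(transpose (B x) ** B x) $ i $ l = mat 1 $ i $ l"
      using B(2)[OF that] by (simp add: orthogonal_matrix_def)
    then show ?thesis by (simp add: matrix_matrix_mult_def transpose_def mat_def)
  qed
  \<comment> \<open>Since the columns of \<open>B x\<close> are unit vectors, this average recovers
    the common tangent direction. It involves no division, so its smoothness is immediate.\<close>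
  define u where "u i x = (\<Sum>j\<in>UNIV. B x $ j $ i *\<^sub>R coord_deriv i (X j) x)" for i x
  have u: "smooth_on D (u i)" for i
    unfolding u_def
    by (intro smooth_on_sum D smooth_on_bilinear[OF bounded_bilinear_scaleR] b smooth_on_coord_deriv X)
  have dX: "coord_deriv i (X j) x = B x $ j $ i *\<^sub>R u i x"
    and de: "coord_deriv i (e k) x = G x $ k $ i *\<^sub>R u i x" if "x \<in> D" for x i j k
  proof -
    \<comment> \<open>Any one normal direction suffices: since \<open>G x $ k0 $ i\<close> is
      non-zero, the derivative of \<open>e k0\<close> yields a vector \<open>t\<close> that does not
      depend on \<open>j\<close>.\<close>
    fix k0 :: 'p
    define t where "t = (1 / G x $ k0 $ i) *\<^sub>R coord_deriv i (e k0) x"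
    have X_t: "coord_deriv i (X j) x = B x $ j $ i *\<^sub>R t" for j
    proof -
      have "B x $ j $ i *\<^sub>R coord_deriv i (e k0) x = G x $ k0 $ i *\<^sub>R coord_deriv i (X j) x"
        using tangent(4)[OF that] .
      then have "(1 / G x $ k0 $ i) *\<^sub>R (B x $ j $ i *\<^sub>R coord_deriv i (e k0) x) = coord_deriv i (X j) x"
        using assms(6)[OF that, of k0 i] by simp
      then show ?thesis by (simp add: t_def)
    qed
    have "u i x = (\<Sum>j\<in>UNIV. B x $ j $ i * B x $ j $ i) *\<^sub>R t"
      by (simp add: u_def X_t scaleR_sum_left)
    then have "u i x = t" using that by (simp add: BB)
    then show *: "coord_deriv i (X j) x = B x $ j $ i *\<^sub>R u i x" for j by (simp add: X_t)
    have "B x $ one $ i *\<^sub>R coord_deriv i (e k) x = B x $ one $ i *\<^sub>R (G x $ k $ i *\<^sub>R u i x)"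
      using tangent(4)[OF that, of one i k] by (simp add: *)
    then show "coord_deriv i (e k) x = G x $ k $ i *\<^sub>R u i x"
      by (rule scaleR_left_imp_eq[OF tangent(1)[OF that]])
  qed
  have uu: "u i x \<bullet> u j x = (if i = j then 1 else 0)" and ue: "u i x \<bullet> e k x = 0"
    if "x \<in> D" for x i j k
  proof -
    have b0: "B x $ one $ i \<noteq> 0" for i
      by (rule tangent(1)[OF that])
    have "coord_deriv i (X one) x \<bullet> coord_deriv j (X one) x = (if i = j then (B x $ one $ i)\<^sup>2 else 0)"
      by (rule tangent(2)[OF that])
    then show "u i x \<bullet> u j x = (if i = j then 1 else 0)"
      using b0[of i] b0[of j] by (auto simp: dX[OF that] power2_eq_square split: if_splits)
    have "coord_deriv i (X one) x \<bullet> e k x = 0"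
      by (rule tangent(3)[OF that])
    then show "u i x \<bullet> e k x = 0"
      using b0[of i] by (simp add: dX[OF that])
  qed
  \<comment> \<open>This is the coefficient of \<open>u j x\<close> that arises when the mixed
    partials of the \<open>X r\<close> are weighted by \<open>B x $ r $ i\<close> and summed. Unlike
    the quotient defining \<open>F\<close>, it is visibly smooth.\<close>
  define f where "f i j x = (\<Sum>r\<in>UNIV. B x $ r $ i * coord_deriv i (\<lambda>y. B y $ r $ j) x)" for i j x
  have f: "smooth_on D (f i j)" for i j
    unfolding f_def
    by (intro smooth_on_sum D smooth_on_bilinear[OF bounded_bilinear_mult] b smooth_on_coord_deriv)
  \<comment> \<open>Multiplying by \<open>B x $ r $ i\<close> and summing over \<open>r\<close>, orthogonality of the columns of \<open>B x\<close>
    isolates \<open>coord_deriv j (u i) x\<close> and kills its components other than \<open>u j x\<close>.\<close>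
  have mixed: "B x $ r $ j *\<^sub>R coord_deriv i (u j) x + coord_deriv i (\<lambda>y. B y $ r $ j) x *\<^sub>R u j x =
      B x $ r $ i *\<^sub>R coord_deriv j (u i) x + coord_deriv j (\<lambda>y. B y $ r $ i) x *\<^sub>R u i x"
    if "x \<in> D" for x i j r
  proof -
    have *: "coord_deriv i (coord_deriv j (X r)) x =
        B x $ r $ j *\<^sub>R coord_deriv i (u j) x + coord_deriv i (\<lambda>y. B y $ r $ j) x *\<^sub>R u j x" for i j
    proof -
      have "coord_deriv i (coord_deriv j (X r)) x = coord_deriv i (\<lambda>y. B y $ r $ j *\<^sub>R u j y) x"
        by (intro coord_deriv_cong[OF D \<open>x \<in> D\<close>] smooth_on_coord_deriv X dX)
      then show ?thesis by (simp add: coord_deriv_scaleR[OF b u \<open>x \<in> D\<close>])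
    qed
    show ?thesis using coord_deriv_commute[OF D X[of r] that, of i j] unfolding * .
  qed
  \<comment> \<open>Half the derivative of the constant squared length of a column.\<close>
  have B_unit: "(\<Sum>r\<in>UNIV. B x $ r $ i * coord_deriv j (\<lambda>y. B y $ r $ i) x) = 0" if "x \<in> D" for x i j
  proof -
    have "coord_deriv j (\<lambda>y. \<Sum>r\<in>UNIV. B y $ r $ i * B y $ r $ i) x = coord_deriv j (\<lambda>y. 1) x"
      by (intro coord_deriv_cong[OF D that] smooth_on_sum D smooth_on_bilinear[OF bounded_bilinear_mult] b)
        (simp add: BB)
    then show ?thesis
      by (simp add: coord_deriv_sum[OF smooth_on_bilinear[OF bounded_bilinear_mult D b b] that]
          coord_deriv_mult[OF b b that] mult.commute flip: sum_distrib_left)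
  qed
  have du: "coord_deriv j (u i) x = f i j x *\<^sub>R u j x" if "x \<in> D" "i \<noteq> j" for x i j
  proof -
    have "(\<Sum>r\<in>UNIV. B x $ r $ i *\<^sub>R (B x $ r $ j *\<^sub>R coord_deriv i (u j) x +
          coord_deriv i (\<lambda>y. B y $ r $ j) x *\<^sub>R u j x)) =
        (\<Sum>r\<in>UNIV. B x $ r $ i *\<^sub>R (B x $ r $ i *\<^sub>R coord_deriv j (u i) x +
          coord_deriv j (\<lambda>y. B y $ r $ i) x *\<^sub>R u i x))"
      by (simp only: mixed[OF that(1), of _ j i])
    then show ?thesis
      using that by (simp add: scaleR_right_distrib sum.distrib BB B_unit f_def flip: scaleR_sum_left)
  qed
  \<comment> \<open>The \<open>u j\<close> component of \<open>mixed\<close> for the row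
    \<open>one\<close> gives the prescribed quotient, as \<open>B x $ one $ i\<close> is
    non-zero.\<close>
  have f_F: "f i j x = F x $ i $ j" if "x \<in> D" "i \<noteq> j" for x i j
  proof -
    have "coord_deriv i (u j) x = f j i x *\<^sub>R u i x" "coord_deriv j (u i) x = f i j x *\<^sub>R u j x"
      using du that by auto
    with arg_cong[OF mixed[OF that(1), of one j i], of "\<lambda>v. v \<bullet> u j x"] that
    have "coord_deriv i (\<lambda>y. B y $ one $ j) x = B x $ one $ i * f i j x"
      by (simp add: inner_add_left uu)
    then show ?thesis
      using assms(4)[OF that] tangent(1)[OF that(1), of one i]
      by (simp add: partial_deriv_eq_coord_deriv)
  qed
  \<comment> \<open>\<open>F\<close> is prescribed only on \<open>D\<close>, so smoothness is
    transferred from \<open>f i j\<close>, or from the zero function on the diagonal, using that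
    \<open>D\<close> is open.\<close>
  have "smooth_on D (\<lambda>x. F x $ i $ j)" for i j
  proof (cases "i = j")
    case True
    then show ?thesis
      using assms(5) smooth_on_cong[OF D, of "\<lambda>x. F x $ i $ j" "\<lambda>x. 0"]
      by (simp add: smooth_on_def Ck_on_const)
  next
    case False
    then show ?thesis using f_F f smooth_on_cong[OF D, of "f i j" "\<lambda>x. F x $ i $ j"] by simp
  qed
  then have F: "smooth_on D F" by (rule smooth_on_matrixI[OF D])
  show ?thesis
    using solves_system_II_of_frame[OF D u e(1) X B(1) F G uu e(2) ue dX de _ assms(5) B(2)] du f_F
    by simp
qed

end
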